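(* Let $\mathcal{A}$ be a finite alphabet, $n\ge1$, and suppose that $X\subseteq\mathcal{A}^{\mathbb{N}}$ has an $n$-fold interleaving factorization $X=X_0\circledast X_1\circledast\cdots\circledast X_{n-2}\circledast X_{n-1}$ with $X_i\subseteq\mathcal{A}^{\mathbb{N}}$. (1) The one-sided shift map $S$ acts by $$S(X)=X_1\circledast X_2\circledast\cdots\circledast X_{n-1}\circledast S(X_0).$$ Consequently $$S^n(X)=S(X_0)\circledast S(X_1)\circledast\cdots\circledast S(X_{n-2})\circledast S(X_{n-1}).$$ (2) All iterates $S^k(X)$ ($k\ge0$) possess $n$-fold interleaving factorizations $$S^k(X)=\psi_{k,n}(X)\circledast\psi_{k+1,n}(X)\circledast\cdots\circledast\psi_{k+n-1,n}(X).$$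
   Context: $\mathbb{N}=\{0,1,2,\dots\}$. The shift is $S(a_0a_1a_2\cdots)=a_1a_2a_3\cdots$, applied elementwise to sets. For $\mathbf{x}=a_0a_1a_2\cdots\in\mathcal{A}^{\mathbb{N}}$, $i\ge0$, $n\ge1$, the decimation is $\psi_{i,n}(\mathbf{x})=a_ia_{i+n}a_{i+2n}\cdots$, and $\psi_{i,n}(X)=\{\psi_{i,n}(\mathbf{x}):\mathbf{x}\in X\}$. The $n$-fold interleaving of sequences $\mathbf{x}_i=a_{i,0}a_{i,1}\cdots$ ($0\le i\le n-1$) is $b_0b_1b_2\cdots$ with $b_{i+jn}=a_{i,j}$ ($0\le i\le n-1$, $j\ge0$); the $n$-fold interleaving $X_0\circledast\cdots\circledast X_{n-1}$ of sets (in this order, a single $n$-ary operation) is the set of all $n$-fold interleavings of $(\mathbf{x}_0,\dots,\mathbf{x}_{n-1})$ with $\mathbf{x}_i\in X_i$. *)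

theory Defs
  imports Main
begin

text \<open>A one-sided sequence over the alphabet \<^typ>\<open>'a\<close> is a function \<^typ>\<open>nat \<Rightarrow> 'a\<close>.\<close>

definition shift :: "(nat \<Rightarrow> 'a) \<Rightarrow> (nat \<Rightarrow> 'a)" where
  "shift x = (\<lambda>j. x (j + 1))"

definition decimation :: "nat \<Rightarrow> nat \<Rightarrow> (nat \<Rightarrow> 'a) \<Rightarrow> (nat \<Rightarrow> 'a)" where
  "decimation i n x = (\<lambda>j. x (i + j * n))"

text \<open>
  The interleaving is \<open>n\<close>-ary, where \<open>n\<close> is the length of the argument list. Writing an index as
  \<open>m = i + j * n\<close> with \<open>i < n\<close> gives the characterization \<open>interleave_at\<close> below.
  The empty list is a junk case.
\<close>

definition interleave :: "(nat \<Rightarrow> 'a) list \<Rightarrow> (nat \<Rightarrow> 'a)" where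
  "interleave xs = (\<lambda>m. (xs ! (m mod length xs)) (m div length xs))"

lemma interleave_at:
  "i < length xs \<Longrightarrow> interleave xs (i + j * length xs) = (xs ! i) j"
  by (cases "length xs = 0") (simp_all add: interleave_def div_add1_eq)

definition interleaving :: "(nat \<Rightarrow> 'a) set list \<Rightarrow> (nat \<Rightarrow> 'a) set" where
  "interleaving Xs =
     {interleave xs | xs. length xs = length Xs \<and> (\<forall>i < length Xs. xs ! i \<in> Xs ! i)}"

end

theory Submission
  imports Defs
begin

text \<open>
  A sequence lies in the interleaving of \<open>X\<^sub>0, \<dots>, X\<^sub>n\<^sub>-\<^sub>1\<close> iff its \<open>i\<close>-th decimation lies in \<open>X\<^sub>i\<close>
  for every \<open>i < n\<close>. Shifting rotates the factors, and the factor moved to the end is shifted once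
  because the \<open>n\<close>-th decimation is the shift of the \<open>0\<close>-th. Iterating, if a family \<open>Y\<close> of sets
  satisfies \<open>Y\<^sub>i\<^sub>+\<^sub>n = S(Y\<^sub>i)\<close> and \<open>X\<close> is the interleaving of \<open>Y\<^sub>0, \<dots>, Y\<^sub>n\<^sub>-\<^sub>1\<close>, then \<open>S\<^sup>k(X)\<close> is the
  interleaving of \<open>Y\<^sub>k, \<dots>, Y\<^sub>k\<^sub>+\<^sub>n\<^sub>-\<^sub>1\<close>; both the shifted factors and the decimations of \<open>X\<close> form
  such a family.
\<close>

lemma decimation_Suc: "decimation (Suc i) n x = decimation i n (shift x)"
  by (simp add: decimation_def shift_def)

lemma decimation_add: "decimation (i + n) n x = shift (decimation i n x)"
  by (simp add: decimation_def shift_def algebra_simps)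

lemma decimation_interleave:
  assumes "i < length xs"
  shows "decimation i (length xs) (interleave xs) = xs ! i"
  using assms by (simp add: decimation_def interleave_at)

lemma interleave_decimations:
  assumes "n > 0"
  shows "interleave (map (\<lambda>i. decimation i n x) [0..<n]) = x"
  using assms by (simp add: interleave_def decimation_def)

text \<open>\<open>interleave\<close> and the tuple of decimations are mutually inverse. For the
  empty list the right side would be vacuous, while \<open>interleaving []\<close> has one
  element.\<close>

lemma mem_interleaving_iff:
  assumes "Xs \<noteq> []"
  shows "x \<in> interleaving Xs \<longleftrightarrow> (\<forall>i < length Xs. decimation i (length Xs) x \<in> Xs ! i)"
proof
  assume "x \<in> interleaving Xs"
  then obtain xs where "x = interleave xs" "length xs = length Xs" "\<forall>i < length Xs. xs ! i \<in> Xs ! i"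
    by (auto simp: interleaving_def)
  then show "\<forall>i < length Xs. decimation i (length Xs) x \<in> Xs ! i"
    by (metis decimation_interleave)
next
  let ?xs = "map (\<lambda>i. decimation i (length Xs) x) [0..<length Xs]"
  assume "\<forall>i < length Xs. decimation i (length Xs) x \<in> Xs ! i"
  then have "length ?xs = length Xs \<and> (\<forall>i < length Xs. ?xs ! i \<in> Xs ! i)"
    by simp
  moreover have "x = interleave ?xs"
    using assms by (simp add: interleave_decimations)
  ultimately show "x \<in> interleaving Xs"
    unfolding interleaving_def by blast
qed

lemma shift_interleaving_Cons:
  "shift ` interleaving (A # L) = interleaving (L @ [shift ` A])"
proof -
  let ?n = "Suc (length L)"
  have dec0: "decimation (length L) ?n (shift x) = shift (decimation 0 ?n x)" for x :: "nat \<Rightarrow> 'a"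
    using decimation_Suc[of "length L" ?n x] decimation_add[of 0 ?n x] by simp
  have L: "x \<in> interleaving (A # L) \<longleftrightarrow>
      decimation 0 ?n x \<in> A \<and> (\<forall>i < length L. decimation i ?n (shift x) \<in> L ! i)" for x
    by (simp add: mem_interleaving_iff All_less_Suc2 decimation_Suc)
  have R: "y \<in> interleaving (L @ [shift ` A]) \<longleftrightarrow>
      decimation (length L) ?n y \<in> shift ` A \<and> (\<forall>i < length L. decimation i ?n y \<in> L ! i)" for y
    by (simp add: mem_interleaving_iff All_less_Suc nth_append)
  show ?thesis
  proof (intro equalityI subsetI)
    fix y assume "y \<in> shift ` interleaving (A # L)"
    then show "y \<in> interleaving (L @ [shift ` A])"
      using L R dec0 by fastforce
  next
    fix y assume y: "y \<in> interleaving (L @ [shift ` A])"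
    then obtain z where z: "z \<in> A" "decimation (length L) ?n y = shift z"
      using R by blast
    \<comment> \<open>Any letter put before \<open>y\<close> gives a preimage under
      \<open>shift\<close>; the letter \<open>z 0\<close> makes the 0-th decimation equal to
      \<open>z\<close> itself, not just to a sequence with the same shift.\<close>
    define x where "x = case_nat (z 0) y"
    have sx: "shift x = y"
      by (simp add: x_def shift_def)
    have "decimation 0 ?n x j = z j" for j
    proof (cases j)
      case 0
      then show ?thesis by (simp add: x_def decimation_def)
    next
      case (Suc m)
      then show ?thesis
        using fun_cong[OF z(2), of m] by (simp add: x_def decimation_def shift_def ac_simps)
    qed
    then have "decimation 0 ?n x = z" ..
    then have "x \<in> interleaving (A # L)"
      using L R y z(1) sx by simp
    then show "y \<in> shift ` interleaving (A # L)"
      using sx by blast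
  qed
qed

lemma funpow_shift_interleaving:
  assumes "n > 0" and Y: "\<And>i. Y (i + n) = shift ` Y i"
  shows "(shift ^^ k) ` interleaving (map Y [0..<n]) = interleaving (map Y [k..<k + n])"
proof (induction k)
  case 0
  then show ?case by simp
next
  case (Suc k)
  have "(shift ^^ Suc k) ` interleaving (map Y [0..<n]) = shift ` interleaving (map Y [k..<k + n])"
    by (simp add: image_comp flip: Suc.IH)
  also have "map Y [k..<k + n] = Y k # map Y [Suc k..<k + n]"
    using \<open>n > 0\<close> by (simp add: upt_conv_Cons)
  also have "shift ` interleaving \<dots> = interleaving (map Y [Suc k..<k + n] @ [Y (k + n)])"
    by (simp add: shift_interleaving_Cons Y)
  also have "map Y [Suc k..<k + n] @ [Y (k + n)] = map Y [Suc k..<Suc k + n]"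
    using \<open>n > 0\<close> by simp
  finally show ?case .
qed

text \<open>Each decimation of \<open>X\<close> lies in the matching factor, which gives the
  nontrivial inclusion. The two may differ: one empty factor makes \<open>X\<close>, and so all its
  decimations, empty.\<close>

lemma interleaving_decimations:
  assumes "n > 0" and X: "X = interleaving (map Xs [0..<n])"
  shows "X = interleaving (map (\<lambda>i. decimation i n ` X) [0..<n])"
proof -
  have X_iff: "x \<in> X \<longleftrightarrow> (\<forall>i < n. decimation i n x \<in> Xs i)" for x
    using \<open>n > 0\<close> by (simp add: X mem_interleaving_iff)
  have "x \<in> interleaving (map (\<lambda>i. decimation i n ` X) [0..<n]) \<longleftrightarrow>
      (\<forall>i < n. decimation i n x \<in> decimation i n ` X)" for x
    using \<open>n > 0\<close> by (simp add: mem_interleaving_iff)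
  then show ?thesis
    using X_iff by (auto simp: image_iff) metis
qed

theorem proposition4p10:
  fixes X :: "(nat \<Rightarrow> 'a::finite) set"
    and Xs :: "nat \<Rightarrow> (nat \<Rightarrow> 'a) set"
    and n :: nat
  assumes "n \<ge> 1"
    and "X = interleaving (map Xs [0..<n])"
  shows "shift ` X = interleaving (map Xs [1..<n] @ [shift ` Xs 0])
    \<and> (shift ^^ n) ` X = interleaving (map (\<lambda>i. shift ` Xs i) [0..<n])
    \<and> (\<forall>k. (shift ^^ k) ` X = interleaving (map (\<lambda>i. decimation i n ` X) [k..<k + n]))"
proof (intro conjI allI)
  have n: "n > 0" using assms(1) by simp
  show "shift ` X = interleaving (map Xs [1..<n] @ [shift ` Xs 0])"
    using n by (simp add: assms(2) upt_conv_Cons shift_interleaving_Cons)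
  show "(shift ^^ n) ` X = interleaving (map (\<lambda>i. shift ` Xs i) [0..<n])"
  proof -
    \<comment> \<open>\<open>Y\<close> continues \<open>Xs\<close> periodically with one more shift
      per period, so the window from \<open>n\<close> to \<open>2n - 1\<close> consists of the
      once-shifted factors.\<close>
    define Y where "Y i = (shift ^^ (i div n)) ` Xs (i mod n)" for i
    have "map Xs [0..<n] = map Y [0..<n]"
      by (simp add: Y_def)
    moreover have "Y (i + n) = shift ` Y i" for i
      using n by (simp add: Y_def image_comp div_add_self2)
    moreover have "map Y [n..<n + n] = map (\<lambda>i. shift ` Xs i) [0..<n]"
      using n by (intro nth_equalityI) (simp_all add: Y_def div_add_self1)
    ultimately show ?thesis
      using funpow_shift_interleaving[OF n, of Y n] assms(2) by metis
  qed
  show "(shift ^^ k) ` X = interleaving (map (\<lambda>i. decimation i n ` X) [k..<k + n])" for k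
    using funpow_shift_interleaving[OF n, of "\<lambda>i. decimation i n ` X" k]
      interleaving_decimations[OF n assms(2)]
    by (simp add: decimation_add image_image)
qed

end
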